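(* If $g\in\mathbb{G}$ is topologically mixing (TM), then $g$ is locally eventually onto (LEO).
   Context: $\lambda$ is Lebesgue measure on $[0,1]$. A continuous map $h:[0,1]\to[0,1]$ is $\lambda$-preserving if $\lambda(A)=\lambda(h^{-1}(A))$ for every Borel set $A\subseteq[0,1]$. A dyadic number is a rational number whose denominator is an integer power of $2$. $\mathbb{G}$ ($\lambda$-preserving Thompson's monoid) is the set of continuous maps $g$ from $[0,1]$ onto $[0,1]$ such that: $g$ is $\lambda$-preserving; $g$ is piecewise affine; $g$ is differentiable except at finitely many points; the $x$-coordinate of each point of non-differentiability is dyadic; and on every interval where $g$ is differentiable, the derivative is of the form $\pm 2^k$ with $k\in\mathbb{Z}$. An interval map $h$ is topologically mixing (TM) if for all nonempty open sets $U,V$ in $[0,1]$ there is an integer $N\ge 0$ such that $h^n(U)\cap V\neq\emptyset$ for all $n\ge N$. It is locally eventually onto (LEO) if for every nonempty open set $U$ in $[0,1]$ there is an integer $N$ such that $h^N(U)=[0,1]$. Here $h^n$ is the $n$-fold iterate. *)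

theory Defs
  imports "HOL-Analysis.Analysis"
begin

(* Interval maps are functions real => real of which only the restriction to {0..1} matters:
   preimages are intersected with {0..1}, and derivatives are taken within {0..1}, hence are
   one-sided at 0 and 1. *)

definition lambda_preserving :: "(real \<Rightarrow> real) \<Rightarrow> bool" where
  "lambda_preserving h \<longleftrightarrow>
     (\<forall>A \<in> sets borel. A \<subseteq> {0..1} \<longrightarrow> emeasure lborel A = emeasure lborel (h -` A \<inter> {0..1}))"

definition dyadic :: "real \<Rightarrow> bool" where
  "dyadic x \<longleftrightarrow> (\<exists>(a::int) (n::nat). x = of_int a / 2 ^ n)"

(* Closed pieces suffice because this is only used for continuous maps. *)
definition piecewise_affine :: "(real \<Rightarrow> real) \<Rightarrow> bool" where
  "piecewise_affine h \<longleftrightarrow>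
     (\<exists>(n::nat) (p :: nat \<Rightarrow> real). p 0 = 0 \<and> p n = 1 \<and> (\<forall>i<n. p i < p (Suc i)) \<and>
        (\<forall>i<n. \<exists>m c. \<forall>x \<in> {p i..p (Suc i)}. h x = m * x + c))"

definition nondiff_points :: "(real \<Rightarrow> real) \<Rightarrow> real set" where
  "nondiff_points h = {x \<in> {0..1}. \<not> h differentiable (at x within {0..1})}"

definition lambda_thompson_monoid :: "(real \<Rightarrow> real) set" where
  "lambda_thompson_monoid = {g.
     continuous_on {0..1} g \<and> g ` {0..1} = {0..1} \<and>
     lambda_preserving g \<and>
     piecewise_affine g \<and>
     finite (nondiff_points g) \<and>
     (\<forall>x \<in> nondiff_points g. dyadic x) \<and>
     (\<forall>a b. 0 \<le> a \<and> a < b \<and> b \<le> 1 \<and> {a<..<b} \<inter> nondiff_points g = {} \<longrightarrow>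
        (\<exists>(k::int). \<exists>s \<in> {1, -1}. \<forall>x \<in> {a<..<b}.
           (g has_real_derivative s * 2 powi k) (at x within {0..1})))}"

definition topologically_mixing :: "(real \<Rightarrow> real) \<Rightarrow> bool" where
  "topologically_mixing h \<longleftrightarrow>
     (\<forall>U V. openin (top_of_set {0..1}) U \<and> U \<noteq> {} \<and> openin (top_of_set {0..1}) V \<and> V \<noteq> {} \<longrightarrow>
        (\<exists>N::nat. \<forall>n\<ge>N. (h ^^ n) ` U \<inter> V \<noteq> {}))"

definition locally_eventually_onto :: "(real \<Rightarrow> real) \<Rightarrow> bool" where
  "locally_eventually_onto h \<longleftrightarrow>
     (\<forall>U. openin (top_of_set {0..1}) U \<and> U \<noteq> {} \<longrightarrow> (\<exists>N::nat. (h ^^ N) ` U = {0..1}))"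

end

theory Submission
  imports Defs
begin

text \<open>
  For every interval \<open>J\<close>, mixing makes the connected sets \<open>g\<^sup>n(J)\<close> eventually contain any prescribed
  interior point of \<open>[0,1]\<close>. It remains to reach an endpoint \<open>e\<close>, which is automatic if some
  interior point is eventually mapped to \<open>e\<close>. If none is, then the backward orbit of \<open>e\<close> stays in
  \<open>{0,1}\<close>, and \<open>e\<close> is either its own only preimage or forms a 2-cycle of endpoints, each
  the only preimage of the other. A piecewise affine \<open>\<lambda>\<close>-preserving map is an isometry near a
  unique preimage of an endpoint, so \<open>g\<close> or \<open>g\<^sup>2\<close> preserves small neighbourhoods of \<open>e\<close>, which
  contradicts mixing.
\<close>

section \<open>Measure and slope near an endpoint\<close>

lemma emeasure_endpoint_nbhd:
  fixes a r :: real
  assumes "a \<in> {0,1}" "0 < r" "r \<le> 1"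
  shows "emeasure lborel {x\<in>{0..1}. \<bar>x - a\<bar> < r} = ennreal r"
proof (cases "a = 0")
  case True
  then have "{x\<in>{0..1}. \<bar>x - a\<bar> < r} = {0..<r}" using assms by auto
  then show ?thesis using assms by simp
next
  case False
  then have "{x\<in>{0..1}. \<bar>x - a\<bar> < r} = {1-r<..1}" using assms by auto
  then show ?thesis using assms by simp
qed

text \<open>The first or the last affine piece supplies the neighbourhood. Measuring by distance to
  \<open>a\<close> lets later arguments treat both ends alike.\<close>

lemma piecewise_affine_near_endpoint:
  assumes "piecewise_affine h" "a \<in> {0,1}"
  obtains m d where "0 < d" "d \<le> 1"
    "\<And>x. x \<in> {0..1} \<Longrightarrow> \<bar>x - a\<bar> < d \<Longrightarrow> h x - h a = m * (x - a)"
proof -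
  obtain n p where p: "p 0 = (0::real)" "p n = 1" "\<forall>i<n. p i < p (Suc i)"
    and aff: "\<forall>i<n. \<exists>m c. \<forall>x \<in> {p i..p (Suc i)}. h x = m * x + c"
    using assms(1) unfolding piecewise_affine_def by blast
  have "n \<noteq> 0" using p by (cases n) auto
  then obtain k where k: "n = Suc k" by (cases n) auto
  consider "a = 0" | "a = 1" using assms(2) by auto
  then show ?thesis
  proof cases
    case 1
    obtain m c where m: "\<forall>x \<in> {p 0..p (Suc 0)}. h x = m * x + c" using aff k by blast
    have "p 0 < p (Suc 0)" using p k by blast
    then show ?thesis
      using m p(1) 1 by (intro that[of "min 1 (p (Suc 0))" m]) (auto simp: algebra_simps)
  next
    case 2
    obtain m c where m: "\<forall>x \<in> {p k..p (Suc k)}. h x = m * x + c" using aff k by blast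
    have "p k < p (Suc k)" using p k by blast
    then show ?thesis
      using m p(2) 2 k by (intro that[of "min 1 (1 - p k)" m]) (auto simp: algebra_simps)
  qed
qed

text \<open>The image of \<open>S\<close> minus the ball around \<open>a\<close> is compact and
  misses \<open>b\<close>, so it keeps a positive distance from \<open>b\<close>.\<close>

lemma compact_preimage_near_unique_point:
  fixes f :: "'a::metric_space \<Rightarrow> 'b::metric_space"
  assumes "compact S" "continuous_on S f" "\<And>x. x \<in> S \<Longrightarrow> f x = b \<Longrightarrow> x = a" "d > 0"
  obtains e where "e > 0" "\<And>x. x \<in> S \<Longrightarrow> dist (f x) b < e \<Longrightarrow> dist x a < d"
proof -
  let ?K = "f ` (S - ball a d)"
  have "compact (S - ball a d)"
    using assms(1) by (simp add: compact_diff)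
  then have "closed ?K"
    by (intro compact_imp_closed compact_continuous_image continuous_on_subset[OF assms(2)]) auto
  moreover have "b \<notin> ?K" using assms(3,4) by force
  ultimately obtain e where e: "e > 0" "ball b e \<subseteq> - ?K"
    using open_contains_ball[of "- ?K"] by blast
  show ?thesis
  proof (rule that[OF e(1)])
    fix x assume "x \<in> S" "dist (f x) b < e"
    then show "dist x a < d" using e(2) by (force simp: dist_commute)
  qed
qed

text \<open>Since no other point maps to \<open>b\<close>, a short interval of length
  \<open>r\<close> at \<open>b\<close> pulls back to a single interval at \<open>a\<close>, of
  length \<open>r / \<bar>m\<bar>\<close> for the local slope \<open>m\<close>. Preservation of
  measure forces \<open>\<bar>m\<bar> = 1\<close>.\<close>

lemma isometry_near_unique_endpoint_preimage:
  assumes cont: "continuous_on {0..1} g" and im: "g ` {0..1} \<subseteq> {0..1}" and lam: "lambda_preserving g" and pa: "piecewise_affine g"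
    and ab: "a \<in> {0,1}" "b \<in> {0,1}" and gab: "g a = b"
    and uniq: "\<And>x. x \<in> {0..1} \<Longrightarrow> g x = b \<Longrightarrow> x = a"
  obtains d where "0 < d" "d \<le> 1"
    "\<And>x. x \<in> {0..1} \<Longrightarrow> \<bar>x - a\<bar> < d \<Longrightarrow> \<bar>g x - b\<bar> = \<bar>x - a\<bar>"
proof -
  obtain m d where d: "0 < d" "d \<le> 1"
    and m: "\<And>x. x \<in> {0..1} \<Longrightarrow> \<bar>x - a\<bar> < d \<Longrightarrow> g x - g a = m * (x - a)"
    using piecewise_affine_near_endpoint[OF pa ab(1)] by metis
  have abs_m: "\<bar>g x - b\<bar> = \<bar>m\<bar> * \<bar>x - a\<bar>" if "x \<in> {0..1}" "\<bar>x - a\<bar> < d" for x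
    using m[OF that] gab by (simp add: abs_mult)
  \<comment> \<open>Slope zero would make \<open>g\<close> constantly \<open>b\<close> near
    \<open>a\<close>, against uniqueness.\<close>
  have "m \<noteq> 0"
  proof
    assume "m = 0"
    define x where "x = (if a = 0 then d/2 else 1 - d/2)"
    have x: "x \<in> {0..1}" "\<bar>x - a\<bar> < d" "x \<noteq> a"
      using d ab by (auto simp: x_def)
    from m[OF x(1,2)] have "g x = b" using \<open>m = 0\<close> gab by simp
    then show False using uniq[OF x(1)] x(3) by blast
  qed
  obtain e where e: "e > 0" "\<And>x. x \<in> {0..1} \<Longrightarrow> dist (g x) b < e \<Longrightarrow> dist x a < d"
    using compact_preimage_near_unique_point[OF compact_Icc cont uniq d(1)] by blast
  \<comment> \<open>The bounds by \<open>e\<close> and \<open>\<bar>m\<bar> * d\<close> make both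
    sides of the equivalence below fail outside the affine range; the bound by 1 is for the length
    formula.\<close>
  define r where "r = min (min e (\<bar>m\<bar> * d)) 1"
  have r: "0 < r" "r \<le> e" "r \<le> 1" "r / \<bar>m\<bar> \<le> d" "0 < r / \<bar>m\<bar>"
    using e(1) d(1) \<open>m \<noteq> 0\<close> by (auto simp: r_def divide_le_eq mult.commute)
  let ?B = "{y\<in>{0..1}. \<bar>y - b\<bar> < r}"
  have preimage: "g -` ?B \<inter> {0..1} = {x\<in>{0..1}. \<bar>x - a\<bar> < r / \<bar>m\<bar>}"
  proof -
    have "\<bar>g x - b\<bar> < r \<longleftrightarrow> \<bar>x - a\<bar> < r / \<bar>m\<bar>" if x: "x \<in> {0..1}" for x
    proof (cases "\<bar>x - a\<bar> < d")
      case True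
      then show ?thesis
        using abs_m[OF x True] \<open>m \<noteq> 0\<close> by (simp add: field_simps)
    next
      case False
      then have "\<not> \<bar>g x - b\<bar> < e" using e(2)[OF x] by (auto simp: dist_real_def)
      with False show ?thesis using r(2,4) by linarith
    qed
    moreover have "g x \<in> {0..1}" if "x \<in> {0..1}" for x using im that by blast
    ultimately show ?thesis by blast
  qed
  have "?B \<in> sets borel" "?B \<subseteq> {0..1}" by auto
  then have "emeasure lborel ?B = emeasure lborel (g -` ?B \<inter> {0..1})"
    using lam unfolding lambda_preserving_def by blast
  then have "emeasure lborel ?B = emeasure lborel {x\<in>{0..1}. \<bar>x - a\<bar> < r / \<bar>m\<bar>}" unfolding preimage .
  then have "ennreal r = ennreal (r / \<bar>m\<bar>)"
    using emeasure_endpoint_nbhd[OF ab(2) r(1,3)]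
      emeasure_endpoint_nbhd[OF ab(1) r(5) order_trans[OF r(4) d(2)]] by simp
  then have "\<bar>m\<bar> = 1"
    using r(1) \<open>m \<noteq> 0\<close> by (simp add: field_simps)
  then show ?thesis using abs_m d by (intro that[of d]) auto
qed

section \<open>Reaching the endpoints under mixing\<close>

lemma funpow_image_subset:
  assumes "g ` S \<subseteq> S"
  shows "(g ^^ n) ` S \<subseteq> S"
  using assms by (induction n) auto

text \<open>A small neighbourhood of \<open>e\<close> is invariant under \<open>g ^^ p\<close>, so
  at every multiple of \<open>p\<close> its image misses the far end of the interval.\<close>

lemma not_mixing_if_isometry_near_endpoint:
  assumes e: "e \<in> {0,1}" and im: "g ` {0..1} \<subseteq> {0..1}" and p: "p > 0" and d: "0 < d" "d \<le> 1"
    and iso: "\<And>x. x \<in> {0..1} \<Longrightarrow> \<bar>x - e\<bar> < d \<Longrightarrow> \<bar>(g ^^ p) x - e\<bar> = \<bar>x - e\<bar>"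
  shows "\<not> topologically_mixing g"
proof
  assume tm: "topologically_mixing g"
  \<comment> \<open>As \<open>d \<le> 1\<close>, radius \<open>d/2\<close> leaves the opposite
    endpoint \<open>1 - e\<close> in \<open>V\<close>.\<close>
  define U where "U = {0..1} \<inter> ball e (d/2)"
  define V where "V = {0..1} \<inter> - cball e (d/2)"
  have "openin (top_of_set {0..1}) U" "openin (top_of_set {0..1}) V"
    unfolding U_def V_def by (auto intro!: openin_open_Int)
  moreover have "e \<in> U" "1 - e \<in> V"
    using e d by (auto simp: U_def V_def dist_real_def)
  ultimately obtain N where N: "\<forall>n\<ge>N. (g ^^ n) ` U \<inter> V \<noteq> {}"
    using tm unfolding topologically_mixing_def by blast
  have "(g ^^ p) ` U \<subseteq> U"
  proof (intro image_subsetI)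
    fix x assume x: "x \<in> U"
    then have "(g ^^ p) x \<in> {0..1}"
      using funpow_image_subset[OF im, of p] unfolding U_def by blast
    with x show "(g ^^ p) x \<in> U"
      using iso[of x] d by (auto simp: U_def dist_real_def abs_minus_commute)
  qed
  then have "(g ^^ (p * N)) ` U \<subseteq> U"
    using funpow_image_subset[of "g ^^ p" U N] by (simp add: funpow_mult)
  moreover have "(g ^^ (p * N)) ` U \<inter> V \<noteq> {}" using N p by simp
  moreover have "U \<inter> V = {}" by (auto simp: U_def V_def)
  ultimately show False by blast
qed

text \<open>Passes from interior points to endpoints: a set whose image at some time contains
  \<open>x\<close> has an image containing \<open>e\<close> exactly \<open>k\<close> steps
  later.\<close>

lemma endpoint_has_interior_iterated_preimage:
  assumes cont: "continuous_on {0..1} g" and onto: "g ` {0..1} = {0..1}"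
    and lam: "lambda_preserving g" and pa: "piecewise_affine g"
    and tm: "topologically_mixing g" and e: "e \<in> {0,1}"
  obtains x k where "x \<in> {0<..<1}" "(g ^^ k) x = e"
proof (rule ccontr)
  note witness = that
  assume contra: "\<not> thesis"
  have no: "(g ^^ k) x \<noteq> e" if "x \<in> {0<..<1}" for x k
    using contra witness[OF that] by blast
  note iso = isometry_near_unique_endpoint_preimage[OF cont equalityD1[OF onto] lam pa]
  note not_mixing = not_mixing_if_isometry_near_endpoint[OF e equalityD1[OF onto]]
  define e' where "e' = 1 - e"
  have e': "e' \<in> {0,1}" and ends: "{0,1} = {e,e'}" "e \<noteq> e'"
    using e by (auto simp: e'_def)
  have interior: "x \<in> {0<..<1}" if "x \<in> {0..1}" "x \<noteq> e" "x \<noteq> e'" for x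
    using that e by (auto simp: e'_def)
  have pre_e: "x = e \<or> x = e'" if "x \<in> {0..1}" "g x = e" for x
    using interior[OF that(1)] no[of x 1] that by auto
  have "\<exists>x\<in>{0..1}. g x = y" if "y \<in> {0,1}" for y
  proof -
    have "y \<in> g ` {0..1}" unfolding onto using that by auto
    then show ?thesis by auto
  qed
  \<comment> \<open>Surjectivity turns "at most one preimage" into an actual value of
    \<open>g\<close> in both cases below.\<close>
  then obtain u u' where u: "u \<in> {0..1}" "g u = e" and u': "u' \<in> {0..1}" "g u' = e'"
    using e e' by metis
  show False
  proof (cases "g e' = e")
    case False
    have uniq: "x = e" if "x \<in> {0..1}" "g x = e" for x
      using pre_e[OF that] that False by auto
    then have "g e = e" using u by metis
    from iso[OF e e this uniq] obtain d where "0 < d" "d \<le> 1"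
      "\<And>x. x \<in> {0..1} \<Longrightarrow> \<bar>x - e\<bar> < d \<Longrightarrow> \<bar>g x - e\<bar> = \<bar>x - e\<bar>" by metis
    then show False using not_mixing[of 1 d] tm by auto
  next
    case True
    \<comment> \<open>A preimage of \<open>e'\<close> reaches \<open>e\<close> in two steps, hence
      is an endpoint; it is not \<open>e'\<close>, which maps to \<open>e\<close>.\<close>
    have uniq': "x = e" if "x \<in> {0..1}" "g x = e'" for x
    proof -
      have "(g ^^ 2) x = e" using that True by (simp add: numeral_2_eq_2)
      then show ?thesis using interior[OF that(1)] no[of x 2] that True ends by auto
    qed
    then have ge: "g e = e'" using u' by metis
    have uniq: "x = e'" if "x \<in> {0..1}" "g x = e" for x
      using pre_e[OF that] that ge ends by auto
    from iso[OF e e' ge uniq'] obtain d where d: "0 < d" "d \<le> 1"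
      "\<And>x. x \<in> {0..1} \<Longrightarrow> \<bar>x - e\<bar> < d \<Longrightarrow> \<bar>g x - e'\<bar> = \<bar>x - e\<bar>" by metis
    from iso[OF e' e True uniq] obtain d' where d': "0 < d'" "d' \<le> 1"
      "\<And>x. x \<in> {0..1} \<Longrightarrow> \<bar>x - e'\<bar> < d' \<Longrightarrow> \<bar>g x - e\<bar> = \<bar>x - e'\<bar>" by metis
    \<comment> \<open>The first step keeps the distance, so \<open>g x\<close> is within
      \<open>d'\<close> of \<open>e'\<close> and the second isometry applies.\<close>
    have "\<bar>(g ^^ 2) x - e\<bar> = \<bar>x - e\<bar>" if "x \<in> {0..1}" "\<bar>x - e\<bar> < min d d'" for x
    proof -
      have "g x \<in> {0..1}" using onto that(1) by blast
      then show ?thesis using d(3)[of x] d'(3)[of "g x"] that by (simp add: numeral_2_eq_2)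
    qed
    then show False using not_mixing[of 2 "min d d'"] tm d(1,2) d'(1) by (simp add: min.coboundedI1)
  qed
qed

section \<open>From mixing to covering the whole interval\<close>

theorem theorem9:
  fixes g :: "real \<Rightarrow> real"
  assumes "g \<in> lambda_thompson_monoid"
    and "topologically_mixing g"
  shows "locally_eventually_onto g"
  unfolding locally_eventually_onto_def
proof (intro allI impI, elim conjE)
  fix U :: "real set"
  assume U: "openin (top_of_set {0..1}) U" "U \<noteq> {}"
  have cont: "continuous_on {0..1} g" and onto: "g ` {0..1} = {0..1}"
    and lam: "lambda_preserving g" and pa: "piecewise_affine g"
    using assms(1) by (auto simp: lambda_thompson_monoid_def)
  note tm = assms(2)
  have into: "(g ^^ n) ` {0..1} \<subseteq> {0..1}" for n
    by (rule funpow_image_subset[OF equalityD1[OF onto]])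
  have cont_n: "continuous_on {0..1} (g ^^ n)" for n
  proof (induction n)
    case (Suc n)
    then show ?case
      using continuous_on_compose[OF Suc continuous_on_subset[OF cont into]] by simp
  qed (simp add: id_def)
  obtain z r where z: "z \<in> U" "r > 0" "ball z r \<inter> {0..1} \<subseteq> U"
    using U unfolding openin_contains_ball by blast
  \<comment> \<open>Shrinking \<open>U\<close> to an interval makes all iterated images
    intervals.\<close>
  define J where "J = {0..1} \<inter> ball z r"
  have "z \<in> J" using z(1,2) openin_imp_subset[OF U(1)] by (auto simp: J_def)
  moreover have "openin (top_of_set {0..1}) J"
    unfolding J_def by (intro openin_open_Int open_ball)
  ultimately have J: "openin (top_of_set {0..1}) J" "J \<noteq> {}" "J \<subseteq> {0..1}" "J \<subseteq> U"
    using z(3) by (auto simp: J_def)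
  have "convex J" unfolding J_def by (intro convex_Int convex_ball) auto
  have interval: "is_interval ((g ^^ n) ` J)" for n
    using connected_continuous_image[OF continuous_on_subset[OF cont_n J(3)]]
      convex_connected[OF \<open>convex J\<close>] by (simp add: is_interval_connected_1)
  \<comment> \<open>Mixing makes late images of \<open>J\<close> meet both sides of
    \<open>x\<close>; being intervals, they contain \<open>x\<close>. This needs both sides
    nonempty, hence \<open>x\<close> interior.\<close>
  have hit: "\<exists>N. \<forall>n\<ge>N. x \<in> (g ^^ n) ` J" if x: "x \<in> {0<..<1}" for x
  proof -
    have "{0..1} \<inter> {..<x} = {0..<x}" "{0..1} \<inter> {x<..} = {x<..1}" using x by auto
    then have "openin (top_of_set {0..1}) {0..<x}" "openin (top_of_set {0..1}) {x<..1}"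
      by (metis openin_open_Int open_lessThan, metis openin_open_Int open_greaterThan)
    moreover have "{0..<x} \<noteq> {}" "{x<..1} \<noteq> {}" using x by auto
    ultimately obtain N1 N2 where N:
      "\<forall>n\<ge>N1. (g ^^ n) ` J \<inter> {0..<x} \<noteq> {}" "\<forall>n\<ge>N2. (g ^^ n) ` J \<inter> {x<..1} \<noteq> {}"
      using tm J unfolding topologically_mixing_def by metis
    have "x \<in> (g ^^ n) ` J" if n: "n \<ge> max N1 N2" for n
    proof -
      obtain y y' where "y \<in> (g ^^ n) ` J" "y \<le> x" "y' \<in> (g ^^ n) ` J" "x \<le> y'"
        using N n by fastforce
      then show ?thesis using interval[of n] unfolding is_interval_1 by blast
    qed
    then show ?thesis by blast
  qed
  have hit_end: "\<exists>N. \<forall>n\<ge>N. e \<in> (g ^^ n) ` J" if e: "e \<in> {0,1}" for e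
  proof -
    obtain x k where x: "x \<in> {0<..<1}" "(g ^^ k) x = e"
      using endpoint_has_interior_iterated_preimage[OF cont onto lam pa tm e] by blast
    obtain N where N: "\<forall>n\<ge>N. x \<in> (g ^^ n) ` J" using hit[OF x(1)] by blast
    have "e \<in> (g ^^ n) ` J" if "n \<ge> k + N" for n
    proof -
      have "x \<in> (g ^^ (n - k)) ` J" using N that by simp
      then have "e \<in> (g ^^ k) ` (g ^^ (n - k)) ` J" using x(2) by blast
      also have "\<dots> = (g ^^ (k + (n - k))) ` J" by (simp only: funpow_add image_comp)
      finally show ?thesis using that by simp
    qed
    then show ?thesis by blast
  qed
  obtain N0 N1 where "\<forall>n\<ge>N0. 0 \<in> (g ^^ n) ` J" "\<forall>n\<ge>N1. 1 \<in> (g ^^ n) ` J"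
    using hit_end[of 0] hit_end[of 1] by auto
  then have "0 \<in> (g ^^ max N0 N1) ` J" "1 \<in> (g ^^ max N0 N1) ` J" by simp_all
  \<comment> \<open>An interval containing 0 and 1 contains everything between.\<close>
  then have "{0..1} \<subseteq> (g ^^ max N0 N1) ` J"
    using interval[of "max N0 N1"] unfolding is_interval_1
    by (meson atLeastAtMost_iff subsetI)
  also have "\<dots> \<subseteq> (g ^^ max N0 N1) ` U" using J(4) by blast
  finally have "(g ^^ max N0 N1) ` U = {0..1}"
    using into[of "max N0 N1"] openin_imp_subset[OF U(1)] by blast
  then show "\<exists>N. (g ^^ N) ` U = {0..1}" by blast
qed

end
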